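(* Let $f\in S$ be fixed, $f(z)=z+\sum_{k=2}^\infty a_kz^k$, and let $n\ge2$ be an arbitrary integer. Then the following statements are equivalent: (a) $|a_n^2-a_{2n-1}|\le(n-1)^2=n^2-(2n-1)$; (b) $|a_n^2-ta_{2n-1}|\le n^2-t(2n-1)$ for all $t\in[0,1]$; (c) $|a_n^2-a_{2n-1}|+r|a_{2n-1}|\le(n-1)^2+r(2n-1)$ for all $r>0$; (d) $|a_n^2-wa_{2n-1}|\le(n-1)^2+|w-1|(2n-1)$ for all $w\in\mathbb{C}$.
   Context: $\mathbb{D}$ is the open unit disk in $\mathbb{C}$. $S$ is the class of all univalent (analytic and one-to-one) functions $f$ in $\mathbb{D}$ with Taylor series $f(z)=z+\sum_{n=2}^\infty a_nz^n$. Condition (a) is the inequality of the Zalcman conjecture. Standing assumption: the Bieberbach conjecture (de Branges' theorem) for odd indices, $|a_{2n-1}|\le2n-1$ for every $f\in S$ and $n\ge2$, is taken for granted. *)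

theory Defs
  imports "HOL-Complex_Analysis.Complex_Analysis"
begin

abbreviation taylor_coeff :: "(complex \<Rightarrow> complex) \<Rightarrow> nat \<Rightarrow> complex" where
  "taylor_coeff f k \<equiv> fps_nth (fps_expansion f 0) k"

(* HOL functions are total, so values outside the unit disk are irrelevant to membership;
   the last two conjuncts say that the Taylor series at 0 starts as 0 + z + ... *)
definition class_S :: "(complex \<Rightarrow> complex) set" where
  "class_S = {f. f holomorphic_on ball 0 1 \<and> inj_on f (ball 0 1) \<and>
                 taylor_coeff f 0 = 0 \<and> taylor_coeff f 1 = 1}"

end

theory Submission
  imports Defs
begin

text \<open>Write \<open>p\<close> for the square of the n-th coefficient, \<open>q\<close> for the
  coefficient of index 2n-1, \<open>M\<close> = (n-1)^2 and \<open>N\<close> = 2n-1. Statement (a)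
  is the case t = 1 of (b), the case w = 1 of (d) and the limit r -> 0+ of (c). Conversely, the
  bound |q| \<le> N from \<open>de_Branges_odd\<close> gives (c) by addition, and (d) by
  \<open>norm_diff_scaled_le\<close>; (b) is (d) restricted to real w in [0,1], because M + N =
  n^2.\<close>

text \<open>Split p - w q as (p - q) - (w - 1) q and apply the triangle inequality.\<close>

lemma norm_diff_scaled_le:
  fixes p q w :: "'a::real_normed_algebra_1"
  assumes "norm (p - q) \<le> M" and "norm q \<le> N"
  shows "norm (p - w * q) \<le> M + norm (w - 1) * N"
proof -
  have "norm (p - w * q) = norm ((p - q) - (w - 1) * q)"
    by (simp add: algebra_simps)
  also have "\<dots> \<le> norm (p - q) + norm ((w - 1) * q)"
    by (rule norm_triangle_ineq4)
  also have "norm ((w - 1) * q) \<le> norm (w - 1) * norm q"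
    by (rule norm_mult_ineq)
  also have "\<dots> \<le> norm (w - 1) * N"
    using assms(2) by (rule mult_left_mono) simp
  finally show ?thesis using assms(1) by simp
qed

lemma le_if_le_add_pos_multiples:
  fixes x q M N :: real
  assumes "0 \<le> q" and "\<And>r. r > 0 \<Longrightarrow> x + r * q \<le> M + r * N"
  shows "x \<le> M"
proof (rule tendsto_lowerbound)
  show "((\<lambda>r. M + r * N) \<longlongrightarrow> M) (at_right 0)"
    by (auto intro!: tendsto_eq_intros)
  show "\<forall>\<^sub>F r in at_right 0. x \<le> M + r * N"
    using eventually_at_right_less[of "0::real"]
  proof eventually_elim
    case (elim r)
    then have "0 \<le> r * q" using assms(1) by simp
    with assms(2)[OF elim] show ?case by linarith
  qed
\<comment> \<open>What remains is that the filter \<open>at_right 0\<close> is nontrivial.\<close>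
qed simp

theorem theorem10:
  fixes f :: "complex \<Rightarrow> complex" and a :: "nat \<Rightarrow> complex" and n :: nat
  assumes de_Branges_odd:
      "\<And>g m. g \<in> class_S \<Longrightarrow> m \<ge> (2::nat) \<Longrightarrow>
         cmod (taylor_coeff g (2 * m - 1)) \<le> 2 * real m - 1"
    and f: "f \<in> class_S"
    and a: "\<And>k. a k = taylor_coeff f k"
    and n: "n \<ge> 2"
  shows "let A = (cmod ((a n)^2 - a (2 * n - 1)) \<le> (real n - 1)^2);
             B = (\<forall>t\<in>{0..1::real}.
                    cmod ((a n)^2 - complex_of_real t * a (2 * n - 1))
                      \<le> (real n)^2 - t * (2 * real n - 1));
             C = (\<forall>r>0::real.
                    cmod ((a n)^2 - a (2 * n - 1)) + r * cmod (a (2 * n - 1))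
                      \<le> (real n - 1)^2 + r * (2 * real n - 1));
             D = (\<forall>w::complex.
                    cmod ((a n)^2 - w * a (2 * n - 1))
                      \<le> (real n - 1)^2 + cmod (w - 1) * (2 * real n - 1))
         in (real n - 1)^2 = (real n)^2 - (2 * real n - 1) \<and>
            (A \<longleftrightarrow> B) \<and> (A \<longleftrightarrow> C) \<and> (A \<longleftrightarrow> D)"
proof -
  define p q where "p = (a n)^2" and "q = a (2 * n - 1)"
  define M N where "M = (real n - 1)^2" and "N = 2 * real n - 1"
  have q: "cmod q \<le> N"
    unfolding q_def N_def a using de_Branges_odd[OF f n] .
  have MN: "M = (real n)^2 - N"
    by (simp add: M_def N_def power2_diff)
  have B: "(cmod (p - q) \<le> M) \<longleftrightarrow>
      (\<forall>t\<in>{0..1::real}. cmod (p - complex_of_real t * q) \<le> (real n)^2 - t * N)"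
  proof (intro iffI ballI)
    fix t :: real
    assume A: "cmod (p - q) \<le> M" and t: "t \<in> {0..1}"
    \<comment> \<open>Here t \<le> 1 fixes the sign, so the bound M + (1 - t) N collapses to n^2 - t
      N.\<close>
    have eq: "cmod (complex_of_real t - 1) = 1 - t"
      using t norm_of_real[of "t - 1", where 'a = complex] by simp
    show "cmod (p - complex_of_real t * q) \<le> (real n)^2 - t * N"
      using norm_diff_scaled_le[OF A q, of "complex_of_real t"] unfolding eq
      by (simp add: MN algebra_simps)
  next
    assume "\<forall>t\<in>{0..1::real}. cmod (p - complex_of_real t * q) \<le> (real n)^2 - t * N"
    from bspec[OF this, of 1] show "cmod (p - q) \<le> M"
      by (simp add: MN)
  qed
  have C: "(cmod (p - q) \<le> M) \<longleftrightarrow>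
      (\<forall>r>0::real. cmod (p - q) + r * cmod q \<le> M + r * N)"
    \<comment> \<open>Forward, add r |q| \<le> r N; backward, r = 0 is excluded, hence the limit
      lemma.\<close>
    using q by (auto intro: add_mono mult_left_mono
        le_if_le_add_pos_multiples[of "cmod q" "cmod (p - q)" M N])
  have D: "(cmod (p - q) \<le> M) \<longleftrightarrow>
      (\<forall>w::complex. cmod (p - w * q) \<le> M + cmod (w - 1) * N)"
  proof (intro iffI allI)
    assume "\<forall>w. cmod (p - w * q) \<le> M + cmod (w - 1) * N"
    from spec[OF this, of 1] show "cmod (p - q) \<le> M" by simp
  qed (rule norm_diff_scaled_le[OF _ q])
  show ?thesis
    using MN B C D unfolding Let_def p_def q_def M_def N_def by (intro conjI)
qed

end
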